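(* If a triangle (in some Euclidean space) has an angle larger than $150^\circ$, then its vertex set is not diameter-Ramsey.
   Context: For a finite set $X$ in a Euclidean space, $\mathrm{diam}(X)$ denotes the largest Euclidean distance between two points of $X$. Two point sets are congruent if there is an isometry mapping one onto the other. A finite set $P$ of points in a Euclidean space is called diameter-Ramsey if for every integer $r\ge 2$ there exist an integer $d=d(P,r)$ and a finite set $R\subset\mathbb{R}^d$ with $\mathrm{diam}(R)=\mathrm{diam}(P)$ such that for every coloring of the points of $R$ with $r$ colors there is a monochromatic subset of $R$ congruent to $P$. *)

theory Defs
  imports "HOL-Analysis.Analysis"
begin

text \<open>
  The dimension \<open>d\<close> of the ambient space is existentially quantified inside the notion
  of a diameter-Ramsey set, so \<open>\<real>\<^sup>d\<close> is given by an explicit carrier: the sequences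
  vanishing from index \<open>d\<close> on (the same encoding as \<^const>\<open>Euclidean_space\<close>), with the
  Euclidean distance on the first \<open>d\<close> coordinates.
\<close>

definition Rn :: "nat \<Rightarrow> (nat \<Rightarrow> real) set" where
  "Rn d = {x. \<forall>i\<ge>d. x i = 0}"

definition Rn_dist :: "nat \<Rightarrow> (nat \<Rightarrow> real) \<Rightarrow> (nat \<Rightarrow> real) \<Rightarrow> real" where
  "Rn_dist d x y = sqrt (\<Sum>i<d. (x i - y i)\<^sup>2)"

text \<open>
  Diameter and congruence take the distance functions as parameters, so that they apply both
  to subsets of a type of class \<^class>\<open>euclidean_space\<close> and to subsets of \<^term>\<open>Rn d\<close>.
  The diameter is only meant for finite sets; the value \<open>0\<close> for the empty set is a convention.
\<close>

definition diam :: "('a \<Rightarrow> 'a \<Rightarrow> real) \<Rightarrow> 'a set \<Rightarrow> real" where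
  "diam \<delta> X = (if X = {} then 0 else Max {\<delta> x y | x y. x \<in> X \<and> y \<in> X})"

definition congruent_sets ::
  "('a \<Rightarrow> 'a \<Rightarrow> real) \<Rightarrow> 'a set \<Rightarrow> ('b \<Rightarrow> 'b \<Rightarrow> real) \<Rightarrow> 'b set \<Rightarrow> bool" where
  "congruent_sets \<delta> X \<epsilon> Y \<longleftrightarrow>
     (\<exists>f. bij_betw f X Y \<and> (\<forall>x\<in>X. \<forall>y\<in>X. \<epsilon> (f x) (f y) = \<delta> x y))"

definition diameter_Ramsey :: "'a::euclidean_space set \<Rightarrow> bool" where
  "diameter_Ramsey P \<longleftrightarrow> finite P \<and>
     (\<forall>r\<ge>2. \<exists>d R. finite R \<and> R \<subseteq> Rn d \<and> diam (Rn_dist d) R = diam dist P \<and>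
        (\<forall>c :: (nat \<Rightarrow> real) \<Rightarrow> nat. (\<forall>x\<in>R. c x < r) \<longrightarrow>
           (\<exists>Q\<subseteq>R. (\<exists>k. \<forall>x\<in>Q. c x = k) \<and> congruent_sets dist P (Rn_dist d) Q)))"

text \<open>The angle \<open>ABC\<close>, with apex at the second argument, in radians.\<close>

definition angle_at :: "'a::euclidean_space \<Rightarrow> 'a \<Rightarrow> 'a \<Rightarrow> real" where
  "angle_at A B C = arccos (((A - B) \<bullet> (C - B)) / (norm (A - B) * norm (C - B)))"

lemma diam_dist_eq_diameter:
  fixes X :: "'a::metric_space set"
  assumes "finite X"
  shows "diam dist X = diameter X"
proof (cases "X = {}")
  case False
  have eq: "{dist x y | x y. x \<in> X \<and> y \<in> X} = (\<lambda>(x, y). dist x y) ` (X \<times> X)"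
    by auto
  show ?thesis
    using assms False by (simp add: diam_def diameter_def eq cSup_eq_Max)
qed (simp add: diam_def)

end

theory Submission
  imports Defs
begin

text \<open>
  If the angle at \<open>C\<close> exceeds \<open>150\<degree>\<close>, then \<open>AB\<close> is the longest side, and the circumradius
  \<open>|AB| / (2 sin \<gamma>)\<close> exceeds \<open>|AB|\<close>. A set \<open>R\<close> of diameter \<open>|AB|\<close> lies in the ball of radius
  \<open>|AB|\<close> around any \<open>p \<in> R\<close>. Cut this ball into finitely many shells of equal, small width in
  the squared distance from \<open>p\<close> and colour each point by its shell. The vertices of a monochromatic
  copy would be nearly equidistant from \<open>p\<close>; but a point equidistant from the vertices has
  distance at least the circumradius from them, so for thin shells this is impossible.
\<close>

lemma Rn_dist_sq: "(Rn_dist d x y)\<^sup>2 = (\<Sum>i<d. (x i - y i)\<^sup>2)"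
  by (simp add: Rn_dist_def sum_nonneg)

lemma Rn_dist_nonneg: "0 \<le> Rn_dist d x y"
  by (simp add: Rn_dist_def sum_nonneg)

lemma diam_ge:
  assumes "finite X" "x \<in> X" "y \<in> X"
  shows "\<delta> x y \<le> diam \<delta> X"
proof -
  have "{\<delta> x y | x y. x \<in> X \<and> y \<in> X} = (\<lambda>(x, y). \<delta> x y) ` (X \<times> X)"
    by auto
  then have "finite {\<delta> x y | x y. x \<in> X \<and> y \<in> X}"
    using assms by simp
  then show ?thesis
    using assms by (auto simp: diam_def intro!: Max_ge)
qed

text \<open>
  This is \<open>0 \<le> |(p - c) - \<alpha> (a - c) - \<beta> (b - c)|\<^sup>2\<close>, with inner products
  rewritten as squared distances.
\<close>

lemma Rn_dist_affine_ineq: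
  "0 \<le> (Rn_dist d c p)\<^sup>2
     - \<alpha> * ((Rn_dist d a c)\<^sup>2 + (Rn_dist d c p)\<^sup>2 - (Rn_dist d a p)\<^sup>2)
     - \<beta> * ((Rn_dist d b c)\<^sup>2 + (Rn_dist d c p)\<^sup>2 - (Rn_dist d b p)\<^sup>2)
     + \<alpha>\<^sup>2 * (Rn_dist d a c)\<^sup>2 + \<beta>\<^sup>2 * (Rn_dist d b c)\<^sup>2
     + \<alpha> * \<beta> * ((Rn_dist d a c)\<^sup>2 + (Rn_dist d b c)\<^sup>2 - (Rn_dist d a b)\<^sup>2)"
  (is "0 \<le> ?rhs")
proof -
  have "0 \<le> (\<Sum>i<d. ((p i - c i) - \<alpha> * (a i - c i) - \<beta> * (b i - c i))\<^sup>2)"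
    by (simp add: sum_nonneg)
  also have "\<dots> = (\<Sum>i<d. (c i - p i)\<^sup>2
      - \<alpha> * ((a i - c i)\<^sup>2 + (c i - p i)\<^sup>2 - (a i - p i)\<^sup>2)
      - \<beta> * ((b i - c i)\<^sup>2 + (c i - p i)\<^sup>2 - (b i - p i)\<^sup>2)
      + \<alpha>\<^sup>2 * (a i - c i)\<^sup>2 + \<beta>\<^sup>2 * (b i - c i)\<^sup>2
      + \<alpha> * \<beta> * ((a i - c i)\<^sup>2 + (b i - c i)\<^sup>2 - (a i - b i)\<^sup>2))"
    by (intro sum.cong refl) algebra
  also have "\<dots> = ?rhs"
    by (simp add: Rn_dist_sq sum.distrib sum_subtractf flip: sum_distrib_left)
  finally show ?thesis .
qed

text \<open>
  For vectors \<open>u, v\<close> with Gram matrix entries \<open>S, T, m\<close>, the point \<open>\<alpha> u + \<beta> v\<close> is the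
  circumcentre of \<open>0, u, v\<close>, and \<open>(\<alpha> S + \<beta> T) / 2\<close> is the squared circumradius.
\<close>

lemma circumcentre_coeffs:
  fixes S T m :: real
  assumes "S > 0" "T > 0" "m < 0" and G: "m\<^sup>2 < S * T" and big: "3 * (S * T) < 4 * m\<^sup>2"
  obtains \<alpha> \<beta> where "\<alpha> > 0" "\<beta> > 0"
    "\<alpha>\<^sup>2 * S + \<beta>\<^sup>2 * T + 2 * \<alpha> * \<beta> * m = (\<alpha> * S + \<beta> * T) / 2"
    "(\<alpha> * S + \<beta> * T) / 2 > S + T - 2 * m"
proof -
  define G where "G = S * T - m\<^sup>2"
  have G0: "G > 0" and G4: "4 * G < S * T"
    using G big by (auto simp: G_def)
  \<comment> \<open>Cramer's rule for the system \<open>lin\<close> proved below, which says that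
    \<alpha> u + \<beta> v is equidistant from 0, u and v; \<open>G\<close> is the Gram
    determinant.\<close>
  define \<alpha> \<beta> where "\<alpha> = T * (S - m) / (2 * G)" and "\<beta> = S * (T - m) / (2 * G)"
  have pos: "\<alpha> > 0" "\<beta> > 0"
    using assms G0 by (auto simp: \<alpha>_def \<beta>_def)
  have "\<alpha> * S + \<beta> * m = S / 2 * ((S * T - m\<^sup>2) / G)" "\<alpha> * m + \<beta> * T = T / 2 * ((S * T - m\<^sup>2) / G)"
    using G0 by (auto simp: \<alpha>_def \<beta>_def field_simps power2_eq_square)
  then have lin: "\<alpha> * S + \<beta> * m = S / 2" "\<alpha> * m + \<beta> * T = T / 2"
    using G0 by (auto simp flip: G_def)
  have "\<alpha>\<^sup>2 * S + \<beta>\<^sup>2 * T + 2 * \<alpha> * \<beta> * m = \<alpha> * (\<alpha> * S + \<beta> * m) + \<beta> * (\<alpha> * m + \<beta> * T)"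
    by algebra
  also have "\<dots> = (\<alpha> * S + \<beta> * T) / 2"
    unfolding lin by (simp add: add_divide_distrib)
  finally have quad: "\<alpha>\<^sup>2 * S + \<beta>\<^sup>2 * T + 2 * \<alpha> * \<beta> * m = (\<alpha> * S + \<beta> * T) / 2" .
  \<comment> \<open>The classical formula for the squared circumradius. Since \<open>G\<close> is
    \<open>S * T\<close> times the squared sine of the angle, \<open>4 * G < S * T\<close> says that
    this sine is below 1/2.\<close>
  have "(\<alpha> * S + \<beta> * T) / 2 = (S * T) * (S + T - 2 * m) / (4 * G)"
    using G0 by (simp add: \<alpha>_def \<beta>_def field_simps)
  moreover have "(S + T - 2 * m) * (4 * G) < (S + T - 2 * m) * (S * T)"
    using assms G4 by (intro mult_strict_left_mono) auto
  ultimately have "(\<alpha> * S + \<beta> * T) / 2 > S + T - 2 * m"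
    using G0 by (simp add: pos_less_divide_eq mult.commute)
  then show thesis
    using that pos quad by blast
qed

text \<open>Used for two points in the same shell. Nonnegativity matters because \<open>nat\<close>
  sends every negative floor to 0.\<close>

lemma abs_diff_less_if_nat_floor_divide_eq:
  fixes x y e :: real
  assumes "e > 0" "x \<ge> 0" "y \<ge> 0" "nat \<lfloor>x / e\<rfloor> = nat \<lfloor>y / e\<rfloor>"
  shows "\<bar>x - y\<bar> < e"
proof -
  have "\<lfloor>x / e\<rfloor> = \<lfloor>y / e\<rfloor>"
    using assms by (simp add: eq_nat_nat_iff)
  then have "\<bar>x / e - y / e\<bar> < 1"
    by linarith
  then have "\<bar>(x - y) / e\<bar> < 1"
    by (simp add: diff_divide_distrib)
  then show ?thesis
    using \<open>e > 0\<close> by (simp add: abs_divide)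
qed

lemma not_diameter_Ramsey_if_angle_gt_150:
  fixes A B C :: "'a::euclidean_space"
  assumes triangle: "\<not> collinear {A, B, C}"
    and angle: "angle_at A C B > 150 * (pi / 180)"
  shows "\<not> diameter_Ramsey {A, B, C}"
proof
  assume Ramsey: "diameter_Ramsey {A, B, C}"
  define u v where "u = A - C" and "v = B - C"
  define S T m where "S = u \<bullet> u" and "T = v \<bullet> v" and "m = u \<bullet> v"
  have nz: "u \<noteq> 0" "v \<noteq> 0"
    using triangle by (auto simp: u_def v_def insert_commute)
  then have ST: "S > 0" "T > 0"
    by (auto simp: S_def T_def)
  \<comment> \<open>Noncollinearity makes Cauchy-Schwarz strict, so the Gram determinant is
    positive.\<close>
  have "\<not> collinear {0, u, v}"
    using triangle collinear_3[of A C B] by (simp add: u_def v_def insert_commute)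
  then have "\<bar>m\<bar> \<noteq> norm u * norm v"
    by (simp add: m_def norm_cauchy_schwarz_equal)
  then have "\<bar>m\<bar> < norm u * norm v"
    using Cauchy_Schwarz_ineq2[of u v] by (simp add: m_def)
  then have "\<bar>m\<bar>\<^sup>2 < (norm u * norm v)\<^sup>2"
    by (intro power_strict_mono) auto
  then have G: "m\<^sup>2 < S * T"
    by (simp add: power_mult_distrib S_def T_def power2_norm_eq_inner)
  define x where "x = m / (norm u * norm v)"
  have x1: "\<bar>x\<bar> \<le> 1"
    using Cauchy_Schwarz_ineq2[of u v] nz by (simp add: x_def m_def)
  have "arccos x > 5 * pi / 6"
    using angle by (simp add: angle_at_def x_def m_def u_def v_def)
  then have "cos (arccos x) < cos (5 * pi / 6)"
    using x1 by (intro cos_monotone_0_pi) (auto intro: arccos_ubound)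
  moreover have "cos (5 * pi / 6) = - (sqrt 3 / 2)"
    using cos_pi_minus[of "pi / 6"] by (simp add: cos_30)
  ultimately have x: "x < - (sqrt 3 / 2)"
    using x1 by (simp add: abs_le_iff)
  then have "(sqrt 3 / 2)\<^sup>2 < (- x)\<^sup>2"
    by (intro power_strict_mono) auto
  then have "3 < 4 * x\<^sup>2"
    by (simp add: power_divide)
  moreover have m: "m = x * (norm u * norm v)"
    using nz by (simp add: x_def)
  then have m2: "m\<^sup>2 = x\<^sup>2 * (S * T)"
    by (simp add: power_mult_distrib S_def T_def power2_norm_eq_inner)
  ultimately have big: "3 * (S * T) < 4 * m\<^sup>2"
    using ST by simp
  have "x < 0"
    using x by (smt (verit) real_sqrt_gt_zero divide_pos_pos)
  then have "m < 0"
    unfolding m using nz by (simp add: mult_neg_pos)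
  define D where "D = S + T - 2 * m"
  have dAC: "(dist A C)\<^sup>2 = S" and dBC: "(dist B C)\<^sup>2 = T"
    by (auto simp: S_def T_def u_def v_def dist_norm power2_norm_eq_inner)
  have dAB: "(dist A B)\<^sup>2 = D"
  proof -
    have "A - B = u - v"
      by (simp add: u_def v_def)
    then show ?thesis
      by (simp add: dist_norm power2_norm_eq_inner D_def S_def T_def m_def inner_diff
          inner_commute)
  qed
  have "dist A C \<le> dist A B" "dist B C \<le> dist A B"
    by (rule power2_le_imp_le; use ST \<open>m < 0\<close> in \<open>simp add: dAB dAC dBC D_def\<close>)+
  then have "diam dist {A, B, C} \<le> dist A B"
    by (subst diam_dist_eq_diameter)
      (auto intro!: diameter_le simp: dist_commute simp flip: dist_norm)
  obtain \<alpha> \<beta> where \<alpha>\<beta>: "\<alpha> > 0" "\<beta> > 0"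
    and quad: "\<alpha>\<^sup>2 * S + \<beta>\<^sup>2 * T + 2 * \<alpha> * \<beta> * m = (\<alpha> * S + \<beta> * T) / 2"
    and large: "(\<alpha> * S + \<beta> * T) / 2 > D"
    unfolding D_def by (rule circumcentre_coeffs[OF ST \<open>m < 0\<close> G big]) blast
  define N where "N = (\<alpha> * S + \<beta> * T) / 2"
  \<comment> \<open>Errors of at most \<open>e\<close> in the two squared-distance differences,
    weighted by \<alpha> and \<beta>, consume only half of the gap between the squared circumradius
    \<open>N\<close> and \<open>D\<close>.\<close>
  define e where "e = (N - D) / (2 * (\<alpha> + \<beta>))"
  have e: "e > 0" "(\<alpha> + \<beta>) * e = (N - D) / 2"
    using \<alpha>\<beta> large by (auto simp: e_def N_def field_simps)
  \<comment> \<open>Shell indices run from 0 to the floor of \<open>D / e\<close>; adding 2 instead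
    of 1 also ensures \<open>r \<ge> 2\<close>.\<close>
  define r where "r = nat \<lfloor>D / e\<rfloor> + 2"
  obtain d R where R: "finite R" "diam (Rn_dist d) R = diam dist {A, B, C}"
    and mono: "\<And>c :: (nat \<Rightarrow> real) \<Rightarrow> nat. (\<forall>x\<in>R. c x < r) \<Longrightarrow>
      \<exists>Q\<subseteq>R. (\<exists>k. \<forall>x\<in>Q. c x = k) \<and> congruent_sets dist {A, B, C} (Rn_dist d) Q"
  proof -
    have "r \<ge> 2"
      by (simp add: r_def)
    then show thesis
      using Ramsey that unfolding diameter_Ramsey_def by blast
  qed
  \<comment> \<open>Even a constant colouring yields a copy of the nonempty triangle.\<close>
  have "R \<noteq> {}"
    using mono[of "\<lambda>_. 0"] by (auto simp: congruent_sets_def r_def bij_betw_def)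
  then obtain p where p: "p \<in> R"
    by blast
  have ball: "(Rn_dist d y p)\<^sup>2 \<le> D" if "y \<in> R" for y
  proof -
    have "Rn_dist d y p \<le> dist A B"
      using diam_ge[of R y p "Rn_dist d"] R p that \<open>diam dist {A, B, C} \<le> dist A B\<close> by simp
    then show ?thesis
      unfolding dAB[symmetric] by (intro power_mono Rn_dist_nonneg)
  qed
  define col where "col y = nat \<lfloor>(Rn_dist d y p)\<^sup>2 / e\<rfloor>" for y
  have "col y < r" if "y \<in> R" for y
  proof -
    have "nat \<lfloor>(Rn_dist d y p)\<^sup>2 / e\<rfloor> \<le> nat \<lfloor>D / e\<rfloor>"
      using ball[OF that] e by (intro nat_mono floor_mono divide_right_mono) auto
    then show ?thesis
      by (simp add: col_def r_def)
  qed
  then obtain Q k where Q: "Q \<subseteq> R" "\<And>y. y \<in> Q \<Longrightarrow> col y = k"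
    and "congruent_sets dist {A, B, C} (Rn_dist d) Q"
    using mono[of col] by blast
  then obtain f where f: "bij_betw f {A, B, C} Q"
    and iso: "\<And>y z. y \<in> {A, B, C} \<Longrightarrow> z \<in> {A, B, C} \<Longrightarrow> Rn_dist d (f y) (f z) = dist y z"
    unfolding congruent_sets_def by blast
  have fQ: "f A \<in> Q" "f B \<in> Q" "f C \<in> Q"
    using f by (auto simp: bij_betw_def)
  have close: "\<bar>(Rn_dist d y p)\<^sup>2 - (Rn_dist d z p)\<^sup>2\<bar> < e" if "y \<in> Q" "z \<in> Q" for y z
    using Q(2)[OF that(1)] Q(2)[OF that(2)] e
    by (intro abs_diff_less_if_nat_floor_divide_eq) (auto simp: col_def)
  have "Rn_dist d (f A) (f B) = dist A B" "Rn_dist d (f A) (f C) = dist A C"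
    "Rn_dist d (f B) (f C) = dist B C"
    by (auto intro: iso)
  then have ineq: "0 \<le> (Rn_dist d (f C) p)\<^sup>2
     - \<alpha> * (S + (Rn_dist d (f C) p)\<^sup>2 - (Rn_dist d (f A) p)\<^sup>2)
     - \<beta> * (T + (Rn_dist d (f C) p)\<^sup>2 - (Rn_dist d (f B) p)\<^sup>2)
     + \<alpha>\<^sup>2 * S + \<beta>\<^sup>2 * T + \<alpha> * \<beta> * (S + T - D)"
    using Rn_dist_affine_ineq[of d "f C" p \<alpha> "f A" \<beta> "f B"] by (simp add: dAB dAC dBC)
  have "\<alpha> * (S - e) \<le> \<alpha> * (S + (Rn_dist d (f C) p)\<^sup>2 - (Rn_dist d (f A) p)\<^sup>2)"
    using close[OF fQ(3,1)] \<alpha>\<beta> by (intro mult_left_mono) linarith+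
  moreover have "\<beta> * (T - e) \<le> \<beta> * (T + (Rn_dist d (f C) p)\<^sup>2 - (Rn_dist d (f B) p)\<^sup>2)"
    using close[OF fQ(3,2)] \<alpha>\<beta> by (intro mult_left_mono) linarith+
  moreover have "(Rn_dist d (f C) p)\<^sup>2 \<le> D"
    using ball fQ Q by blast
  moreover have "\<alpha> * \<beta> * (S + T - D) = 2 * \<alpha> * \<beta> * m"
    by (simp add: D_def)
  \<comment> \<open>As \<alpha> S + \<beta> T is \<open>2 * N\<close>, exact equidistance would give
    \<open>0 \<le> D - N\<close>; the shell width only adds half of the gap.\<close>
  ultimately have "0 \<le> D - \<alpha> * (S - e) - \<beta> * (T - e) + N"
    using ineq quad unfolding N_def by linarith
  also have "\<dots> = D - N + (\<alpha> + \<beta>) * e"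
    by (simp add: N_def field_simps)
  also have "\<dots> = (D - N) / 2"
    unfolding e(2) by (simp add: field_simps)
  finally show False
    using large[folded N_def] by simp
qed

theorem theorem4:
  fixes A B C :: "'a::euclidean_space"
  assumes triangle: "\<not> collinear {A, B, C}"
    and angle: "angle_at C A B > 150 * (pi / 180) \<or> angle_at A B C > 150 * (pi / 180)
                \<or> angle_at B C A > 150 * (pi / 180)"
  shows "\<not> diameter_Ramsey {A, B, C}"
proof -
  \<comment> \<open>The three cases differ only in which vertex is the apex.\<close>
  have perm: "{C, B, A} = {A, B, C}" "{A, C, B} = {A, B, C}" "{B, A, C} = {A, B, C}"
    by auto
  show ?thesis
    using angle triangle not_diameter_Ramsey_if_angle_gt_150[of C B A]
      not_diameter_Ramsey_if_angle_gt_150[of A C B]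
      not_diameter_Ramsey_if_angle_gt_150[of B A C]
    unfolding perm by blast
qed

end
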